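(* Let $n_1,n_2,n_3,m$ be non-negative integers, $n=n_1+n_2+n_3$, let $\mathcal H\in C^1(\mathbb R^{n_1}\times\mathbb R^{n_2})$, $e\in C(\mathbb R^{n_1}\times\mathbb R^{n_2},\mathbb R^{n_2})$, $\mathcal E\in\mathbb R^{n_2\times n_2}$ (possibly singular), $\mathcal J,\mathcal R\in\mathbb R^{n\times n}$ and $\mathcal B\in\mathbb R^{n\times m}$ satisfy $\mathcal J=-\mathcal J^\top$, $\mathcal R=\mathcal R^\top\ge 0$ (positive semi-definite), and $\mathcal E^\top e(z_1,z_2)=\nabla_{z_2}\mathcal H(z_1,z_2)$ for all $(z_1,z_2)$. Let $u\colon[t_0,t_{\mathrm f}]\to\mathbb R^m$ be a sufficiently smooth input, and let $z=(z_1,z_2,z_3)\in C^1([t_0,t_{\mathrm f}],\mathbb R^{n_1}\times\mathbb R^{n_2}\times\mathbb R^{n_3})$ and $y\in C([t_0,t_{\mathrm f}],\mathbb R^m)$ satisfy $$\begin{bmatrix}\nabla_{z_1}\mathcal H(z_1,z_2)\\ \mathcal E\frac{\mathrm d}{\mathrm dt}z_2\\ 0\end{bmatrix}=(\mathcal J-\mathcal R)\begin{bmatrix}\frac{\mathrm d}{\mathrm dt}z_1\\ e(z_1,z_2)\\ z_3\end{bmatrix}+\mathcal B u,\qquad y=\mathcal B^\top\begin{bmatrix}\frac{\mathrm d}{\mathrm dt}z_1\\ e(z_1,z_2)\\ z_3\end{bmatrix}.$$ Then the energy satisfies $$\frac{\mathrm d}{\mathrm dt}\mathcal H(z_1(t),z_2(t))\le\langle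 y(t),u(t)\rangle$$ on $[t_0,t_{\mathrm f}]$. In particular, for $u=0$ the system is energy dissipative, i.e. $\frac{\mathrm d}{\mathrm dt}\mathcal H(z_1(t),z_2(t))\le 0$.
   Context: $\langle\cdot,\cdot\rangle$ denotes the Euclidean inner product. $\mathcal H$ is called the Hamiltonian (energy) and $e$ the effort. *)

theory Defs
  imports "HOL-Analysis.Analysis" "Jordan_Normal_Form.Matrix"
begin

unbundle no inner_syntax
unbundle no vec_syntax

text \<open>
  The space of real \<open>n\<close>-vectors is \<open>carrier_vec n\<close>, so that every dimension, including \<open>0\<close>, is
  covered (the Euclidean spaces given by type classes all have positive dimension). Linear algebra
  is that of \<^typ>\<open>real mat\<close>; since \<^typ>\<open>real vec\<close> is not a normed space, its Euclidean
  topology and the Frechet gradient are introduced here.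
\<close>

definition vec_top :: "nat \<Rightarrow> real vec topology" where
  "vec_top n = pullback_topology (carrier_vec n) (\<lambda>v i. if i < n then v $ i else 0) (Euclidean_space n)"

lemma topspace_vec_top [simp]: "topspace (vec_top n) = carrier_vec n"
  by (auto simp: vec_top_def topspace_pullback_topology topspace_Euclidean_space)

definition vec_norm :: "real vec \<Rightarrow> real" where
  "vec_norm v = sqrt (v \<bullet> v)"

definition has_gradient :: "nat \<Rightarrow> (real vec \<Rightarrow> real) \<Rightarrow> real vec \<Rightarrow> real vec \<Rightarrow> bool" where
  "has_gradient n f g x \<longleftrightarrow> g \<in> carrier_vec n \<and>
     (\<forall>\<epsilon>>0. \<exists>\<delta>>0. \<forall>h\<in>carrier_vec n. vec_norm h < \<delta> \<longrightarrow>
        \<bar>f (x + h) - f x - g \<bullet> h\<bar> \<le> \<epsilon> * vec_norm h)"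

definition grad :: "nat \<Rightarrow> (real vec \<Rightarrow> real) \<Rightarrow> real vec \<Rightarrow> real vec" where
  "grad n f x = (THE g. has_gradient n f g x)"

definition C1_fun :: "nat \<Rightarrow> (real vec \<Rightarrow> real) \<Rightarrow> bool" where
  "C1_fun n f \<longleftrightarrow> (\<forall>x\<in>carrier_vec n. \<exists>g. has_gradient n f g x)
     \<and> continuous_map (vec_top n) (vec_top n) (grad n f)"

text \<open>Joint \<open>C\<^sup>1\<close> regularity, identifying a pair \<open>(x, y)\<close> with the concatenation \<open>x @\<^sub>v y\<close>.\<close>

definition C1_fun2 :: "nat \<Rightarrow> nat \<Rightarrow> (real vec \<Rightarrow> real vec \<Rightarrow> real) \<Rightarrow> bool" where
  "C1_fun2 n1 n2 f \<longleftrightarrow> C1_fun (n1 + n2) (\<lambda>w. f (vec_first w n1) (vec_last w n2))"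

text \<open>Derivatives of curves on \<open>I\<close> are taken within \<open>I\<close>, i.e. they are one-sided at end points.\<close>

definition curve_deriv :: "nat \<Rightarrow> real set \<Rightarrow> (real \<Rightarrow> real vec) \<Rightarrow> real \<Rightarrow> real vec" where
  "curve_deriv n I z t = vec n (\<lambda>i. vector_derivative (\<lambda>s. z s $ i) (at t within I))"

definition C0_curve :: "nat \<Rightarrow> real set \<Rightarrow> (real \<Rightarrow> real vec) \<Rightarrow> bool" where
  "C0_curve n I z \<longleftrightarrow> continuous_map (top_of_set I) (vec_top n) z"

definition C1_curve :: "nat \<Rightarrow> real set \<Rightarrow> (real \<Rightarrow> real vec) \<Rightarrow> bool" where
  "C1_curve n I z \<longleftrightarrow> z \<in> I \<rightarrow> carrier_vec n
     \<and> (\<forall>t\<in>I. \<forall>i<n. (\<lambda>s. z s $ i) differentiable (at t within I))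
     \<and> C0_curve n I (curve_deriv n I z)"

text \<open>The gradient is unique, so that \<^const>\<open>grad\<close> is the gradient wherever one exists.\<close>

lemma vec_norm_smult: "vec_norm (c \<cdot>\<^sub>v v) = \<bar>c\<bar> * vec_norm v"
  by (simp add: vec_norm_def power2_eq_square[symmetric] real_sqrt_mult mult.assoc[symmetric])

lemma scalar_prod_self_eq_0:
  fixes v :: "real vec"
  assumes "v \<in> carrier_vec n" "v \<bullet> v = 0"
  shows "v = 0\<^sub>v n"
proof -
  have "(\<Sum>i\<in>{0..<n}. v $ i * v $ i) = 0"
    using assms by (simp add: scalar_prod_def)
  then have "\<forall>i\<in>{0..<n}. v $ i * v $ i = 0"
    by (subst (asm) sum_nonneg_eq_0_iff) auto
  then show ?thesis
    using assms(1) by (intro eq_vecI) auto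
qed

lemma has_gradient_unique:
  assumes "has_gradient n f g x" "has_gradient n f g' x"
  shows "g = g'"
proof -
  have c: "g \<in> carrier_vec n" "g' \<in> carrier_vec n"
    using assms by (auto simp: has_gradient_def)
  define d where "d = g - g'"
  have d: "d \<in> carrier_vec n" using c by (simp add: d_def)
  have nn: "0 \<le> d \<bullet> d" by (auto simp: scalar_prod_def intro: sum_nonneg)
  have "vec_norm d = 0"
  proof (rule ccontr)
    assume "vec_norm d \<noteq> 0"
    then have N: "vec_norm d > 0"
      using nn by (simp add: vec_norm_def less_le)
    define \<epsilon> where "\<epsilon> = vec_norm d / 3"
    have e: "\<epsilon> > 0" using N by (simp add: \<epsilon>_def)
    obtain d1 where d1: "d1 > 0" "\<And>h. h \<in> carrier_vec n \<Longrightarrow> vec_norm h < d1 \<Longrightarrow>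
        \<bar>f (x + h) - f x - g \<bullet> h\<bar> \<le> \<epsilon> * vec_norm h"
      using assms(1) e unfolding has_gradient_def by meson
    obtain d2 where d2: "d2 > 0" "\<And>h. h \<in> carrier_vec n \<Longrightarrow> vec_norm h < d2 \<Longrightarrow>
        \<bar>f (x + h) - f x - g' \<bullet> h\<bar> \<le> \<epsilon> * vec_norm h"
      using assms(2) e unfolding has_gradient_def by meson
    define s where "s = min d1 d2 / (2 * vec_norm d)"
    have s: "s > 0" using N d1 d2 by (simp add: s_def)
    define h where "h = s \<cdot>\<^sub>v d"
    have h: "h \<in> carrier_vec n" using d by (simp add: h_def)
    have hs: "vec_norm h = s * vec_norm d" using s by (simp add: h_def vec_norm_smult)
    have "s * vec_norm d = min d1 d2 / 2" using N by (simp add: s_def)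
    then have hn: "vec_norm h < d1" "vec_norm h < d2"
      using hs d1(1) d2(1) by auto
    have "\<bar>g \<bullet> h - g' \<bullet> h\<bar> \<le> 2 * \<epsilon> * vec_norm h"
      using d1(2)[OF h hn(1)] d2(2)[OF h hn(2)] by linarith
    moreover have "g \<bullet> h - g' \<bullet> h = d \<bullet> h"
      using c h by (simp add: d_def minus_scalar_prod_distrib)
    moreover have "d \<bullet> h = s * (d \<bullet> d)"
      using d by (simp add: h_def)
    moreover have "d \<bullet> d = vec_norm d * vec_norm d"
      using nn by (simp add: vec_norm_def)
    ultimately have "\<bar>s * (vec_norm d * vec_norm d)\<bar> \<le> 2 * (vec_norm d / 3) * (s * vec_norm d)"
      by (simp only: hs \<epsilon>_def)
    then have "s * (vec_norm d * vec_norm d) \<le> 2 / 3 * (s * (vec_norm d * vec_norm d))"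
      by (simp add: mult.commute mult.left_commute)
    moreover have "s * (vec_norm d * vec_norm d) > 0" using s N by simp
    ultimately show False by linarith
  qed
  then have "d \<bullet> d = 0" using nn by (simp add: vec_norm_def)
  then have "d = 0\<^sub>v n" using d scalar_prod_self_eq_0 by blast
  then have "\<forall>i<n. g $ i - g' $ i = 0"
    using c unfolding d_def by (metis carrier_vecD index_minus_vec(1) index_zero_vec(1))
  then show ?thesis using c by (intro eq_vecI) auto
qed

lemma grad_eq: "has_gradient n f g x \<Longrightarrow> grad n f x = g"
  unfolding grad_def by (blast intro: has_gradient_unique)

text \<open>
  In positive dimension this is the library derivative: enumerating the basis of a Euclidean space
  as \<open>b 0, \<dots>, b (n - 1)\<close> gives coordinates in \<open>carrier_vec n\<close>.
\<close>

lemma has_gradient_iff_has_derivative: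
  fixes b :: "nat \<Rightarrow> 'a::euclidean_space"
  assumes b: "bij_betw b {..<n} Basis" and g: "g \<in> carrier_vec n"
  defines "\<phi> \<equiv> \<lambda>x. vec n (\<lambda>i. inner x (b i))"
  shows "has_gradient n f g (\<phi> x) \<longleftrightarrow> ((\<lambda>x. f (\<phi> x)) has_derivative (\<lambda>h. g \<bullet> \<phi> h)) (at x)"
proof -
  have nrm: "vec_norm (\<phi> h) = norm h" for h
  proof -
    have "\<phi> h \<bullet> \<phi> h = (\<Sum>i<n. inner h (b i) * inner h (b i))"
      by (simp add: \<phi>_def scalar_prod_def lessThan_atLeast0)
    also have "\<dots> = (\<Sum>u\<in>Basis. inner h u * inner h u)"
      by (rule sum.reindex_bij_betw[OF b])
    also have "\<dots> = inner h h" by (rule euclidean_inner[symmetric])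
    finally show ?thesis by (simp add: vec_norm_def norm_eq_sqrt_inner)
  qed
  have add: "\<phi> (x + h) = \<phi> x + \<phi> h" for x h
    by (auto simp: \<phi>_def inner_add_left)
  have sc: "\<phi> (c *\<^sub>R h) = c \<cdot>\<^sub>v \<phi> h" for c h
    by (auto simp: \<phi>_def)
  have car: "\<phi> h \<in> carrier_vec n" for h by (simp add: \<phi>_def)
  have surj: "\<exists>h. v = \<phi> h" if v: "v \<in> carrier_vec n" for v
  proof -
    define h where "h = (\<Sum>j<n. (v $ j) *\<^sub>R b j)"
    have "inner h (b i) = v $ i" if "i < n" for i
    proof -
      have "inner (b j) (b i) = (if j = i then 1 else 0)" if "j < n" for j
        using b \<open>i < n\<close> that unfolding bij_betw_def
        by (metis (no_types, lifting) imageI inj_on_eq_iff inner_Basis lessThan_iff)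
      then have "inner h (b i) = (\<Sum>j<n. v $ j * (if j = i then 1 else 0))"
        unfolding h_def inner_sum_left by (intro sum.cong) auto
      also have "\<dots> = (\<Sum>j<n. if j = i then v $ j else 0)"
        by (intro sum.cong) auto
      also have "\<dots> = v $ i" using that by simp
      finally show ?thesis .
    qed
    then have "v = \<phi> h" using v by (intro eq_vecI) (auto simp: \<phi>_def)
    then show ?thesis ..
  qed
  have lin: "linear (\<lambda>h. g \<bullet> \<phi> h)"
    using g car by (intro linearI) (simp_all add: add sc scalar_prod_add_distrib[of _ n])
  have all_vec: "(\<forall>v\<in>carrier_vec n. P v) \<longleftrightarrow> (\<forall>h. P (\<phi> h))" for P
    using car surj by blast
  have shift: "(\<forall>h. P h (x + h)) \<longleftrightarrow> (\<forall>y. P (y - x) y)" for P :: "'a \<Rightarrow> 'a \<Rightarrow> bool"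
    by (metis add.commute add_diff_cancel diff_add_cancel)
  have "has_gradient n f g (\<phi> x) \<longleftrightarrow>
      (\<forall>\<epsilon>>0. \<exists>\<delta>>0. \<forall>h. norm h < \<delta> \<longrightarrow> \<bar>f (\<phi> (x + h)) - f (\<phi> x) - g \<bullet> \<phi> h\<bar> \<le> \<epsilon> * norm h)"
    unfolding has_gradient_def all_vec by (simp add: g nrm add)
  also have "\<dots> \<longleftrightarrow> (\<forall>\<epsilon>>0. \<exists>\<delta>>0. \<forall>y. norm (y - x) < \<delta> \<longrightarrow>
        norm (f (\<phi> y) - f (\<phi> x) - g \<bullet> \<phi> (y - x)) \<le> \<epsilon> * norm (y - x))"
    unfolding real_norm_def
    by (subst shift[where P = "\<lambda>h y. norm h < _ \<longrightarrow> \<bar>f (\<phi> y) - f (\<phi> x) - g \<bullet> \<phi> h\<bar> \<le> _ * norm h"]) (rule refl)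
  also have "\<dots> \<longleftrightarrow> ((\<lambda>x. f (\<phi> x)) has_derivative (\<lambda>h. g \<bullet> \<phi> h)) (at x)"
    unfolding has_derivative_at_alt using lin by (simp add: linear_conv_bounded_linear)
  finally show ?thesis .
qed

end

theory Submission
  imports Defs
begin

text \<open>
  By the chain rule the energy has derivative
  \<open>\<langle>\<nabla>\<^sub>1 H, z\<^sub>1'\<rangle> + \<langle>\<nabla>\<^sub>2 H, z\<^sub>2'\<rangle>\<close>. As \<open>\<nabla>\<^sub>2 H = E\<^sup>T e\<close>, this is the inner product of
  \<open>v = (z\<^sub>1', e, z\<^sub>3)\<close> with the left-hand side of the state equation, hence equals
  \<open>\<langle>v, J v\<rangle> - \<langle>v, R v\<rangle> + \<langle>v, B u\<rangle>\<close>. The first term vanishes by skew-symmetry, the second is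
  non-positive, and the third is \<open>\<langle>B\<^sup>T v, u\<rangle> = \<langle>y, u\<rangle>\<close>.
\<close>

section \<open>Gradients: partial gradients and the chain rule along curves\<close>

lemma vec_norm_le_sum_abs:
  assumes "v \<in> carrier_vec n"
  shows "vec_norm v \<le> (\<Sum>i<n. \<bar>v $ i\<bar>)"
proof -
  have "vec_norm v = L2_set (\<lambda>i. v $ i) {..<n}"
    using assms by (simp add: vec_norm_def L2_set_def scalar_prod_def power2_eq_square lessThan_atLeast0)
  then show ?thesis
    by (simp add: L2_set_le_sum_abs)
qed

lemma vec_norm_append_zero: "vec_norm (v @\<^sub>v 0\<^sub>v k) = vec_norm v" "vec_norm (0\<^sub>v k @\<^sub>v v) = vec_norm v"
  by (simp_all add: vec_norm_def
    scalar_prod_append[of _ "dim_vec v" _ k] scalar_prod_append[of _ k _ "dim_vec v"])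

lemma has_gradientD:
  assumes "has_gradient n f g x" "\<epsilon> > 0"
  obtains \<delta> where "\<delta> > 0" "\<And>h. h \<in> carrier_vec n \<Longrightarrow> vec_norm h < \<delta> \<Longrightarrow>
    \<bar>f (x + h) - f x - g \<bullet> h\<bar> \<le> \<epsilon> * vec_norm h"
  using assms unfolding has_gradient_def by meson

text \<open>Restricting the joint expansion to increments \<open>(h, 0)\<close> and
  \<open>(0, h)\<close> freezes one argument. Since padding with zeros preserves the norm, the same
  \<open>\<delta>\<close> serves for each block.\<close>

lemma has_gradient_partial:
  assumes g: "has_gradient (n1 + n2) (\<lambda>w. f (vec_first w n1) (vec_last w n2)) (g1 @\<^sub>v g2) (x1 @\<^sub>v x2)"
    and c: "g1 \<in> carrier_vec n1" "g2 \<in> carrier_vec n2" "x1 \<in> carrier_vec n1" "x2 \<in> carrier_vec n2"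
  shows "has_gradient n1 (\<lambda>x. f x x2) g1 x1" "has_gradient n2 (\<lambda>x. f x1 x) g2 x2"
proof -
  have split: "vec_first (a @\<^sub>v b) n1 = a" "vec_last (a @\<^sub>v b) n2 = b"
    if "a \<in> carrier_vec n1" "b \<in> carrier_vec n2" for a b :: "real vec"
    using that by (auto simp: vec_first_def vec_last_def)
  have est: "\<exists>\<delta>>0. \<forall>a\<in>carrier_vec n1. \<forall>b\<in>carrier_vec n2. vec_norm (a @\<^sub>v b) < \<delta> \<longrightarrow>
      \<bar>f (x1 + a) (x2 + b) - f x1 x2 - (g1 \<bullet> a + g2 \<bullet> b)\<bar> \<le> \<epsilon> * vec_norm (a @\<^sub>v b)"
    if "\<epsilon> > 0" for \<epsilon>
  proof -
    obtain \<delta> where \<delta>: "\<delta> > 0" "\<And>h. h \<in> carrier_vec (n1 + n2) \<Longrightarrow> vec_norm h < \<delta> \<Longrightarrow>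
       \<bar>f (vec_first ((x1 @\<^sub>v x2) + h) n1) (vec_last ((x1 @\<^sub>v x2) + h) n2)
         - f (vec_first (x1 @\<^sub>v x2) n1) (vec_last (x1 @\<^sub>v x2) n2) - (g1 @\<^sub>v g2) \<bullet> h\<bar> \<le> \<epsilon> * vec_norm h"
      using has_gradientD[OF g \<open>\<epsilon> > 0\<close>] by blast
    have "\<bar>f (x1 + a) (x2 + b) - f x1 x2 - (g1 \<bullet> a + g2 \<bullet> b)\<bar> \<le> \<epsilon> * vec_norm (a @\<^sub>v b)"
      if ab: "a \<in> carrier_vec n1" "b \<in> carrier_vec n2" and "vec_norm (a @\<^sub>v b) < \<delta>" for a b
      using \<delta>(2)[of "a @\<^sub>v b"] that c
      by (simp add: split append_vec_add[OF c(3) ab(1) c(4) ab(2)] scalar_prod_append[OF c(1,2) ab])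
    with \<delta>(1) show ?thesis by blast
  qed
  show "has_gradient n1 (\<lambda>x. f x x2) g1 x1"
    unfolding has_gradient_def
  proof (intro conjI allI impI)
    fix \<epsilon> :: real assume "\<epsilon> > 0"
    from est[OF this] obtain \<delta> where \<delta>: "\<delta> > 0" "\<And>a b. a \<in> carrier_vec n1 \<Longrightarrow> b \<in> carrier_vec n2 \<Longrightarrow>
      vec_norm (a @\<^sub>v b) < \<delta> \<Longrightarrow>
      \<bar>f (x1 + a) (x2 + b) - f x1 x2 - (g1 \<bullet> a + g2 \<bullet> b)\<bar> \<le> \<epsilon> * vec_norm (a @\<^sub>v b)"
      by blast
    show "\<exists>\<delta>>0. \<forall>h\<in>carrier_vec n1. vec_norm h < \<delta> \<longrightarrow>
        \<bar>f (x1 + h) x2 - f x1 x2 - g1 \<bullet> h\<bar> \<le> \<epsilon> * vec_norm h"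
      using \<delta>(1) \<delta>(2)[of _ "0\<^sub>v n2"] c by (intro exI[of _ \<delta>]) (simp add: vec_norm_append_zero)
  qed (rule c)
  show "has_gradient n2 (\<lambda>x. f x1 x) g2 x2"
    unfolding has_gradient_def
  proof (intro conjI allI impI)
    fix \<epsilon> :: real assume "\<epsilon> > 0"
    from est[OF this] obtain \<delta> where \<delta>: "\<delta> > 0" "\<And>a b. a \<in> carrier_vec n1 \<Longrightarrow> b \<in> carrier_vec n2 \<Longrightarrow>
      vec_norm (a @\<^sub>v b) < \<delta> \<Longrightarrow>
      \<bar>f (x1 + a) (x2 + b) - f x1 x2 - (g1 \<bullet> a + g2 \<bullet> b)\<bar> \<le> \<epsilon> * vec_norm (a @\<^sub>v b)"
      by blast
    show "\<exists>\<delta>>0. \<forall>h\<in>carrier_vec n2. vec_norm h < \<delta> \<longrightarrow>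
        \<bar>f x1 (x2 + h) - f x1 x2 - g2 \<bullet> h\<bar> \<le> \<epsilon> * vec_norm h"
      using \<delta>(1) \<delta>(2)[of "0\<^sub>v n1"] c by (intro exI[of _ \<delta>]) (simp add: vec_norm_append_zero)
  qed (rule c)
qed

text \<open>The first-order remainder of \<open>f\<close> is small relative to
  \<open>vec_norm (w s - w t)\<close>, and this norm is at most a constant times
  \<open>\<bar>s - t\<bar>\<close> near \<open>t\<close>, because the difference quotients of the
  components converge. Working in the filter \<open>at t within I\<close> covers end points as
  well.\<close>

lemma has_gradient_chain:
  assumes g: "has_gradient n f g (w t)"
    and w: "\<And>s. s \<in> I \<Longrightarrow> w s \<in> carrier_vec n" and t: "t \<in> I"
    and d: "d \<in> carrier_vec n"
    and w': "\<And>i. i < n \<Longrightarrow> ((\<lambda>s. w s $ i) has_real_derivative d $ i) (at t within I)"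
  shows "((\<lambda>s. f (w s)) has_real_derivative g \<bullet> d) (at t within I)"
proof -
  define F where "F = at t within I"
  have gc: "g \<in> carrier_vec n" using g by (simp add: has_gradient_def)
  \<comment> \<open>Membership in \<open>I\<close> gives \<open>w s\<close> its dimension, and
    \<open>s \<noteq> t\<close> permits division by \<open>s - t\<close>.\<close>
  have inI: "\<forall>\<^sub>F s in F. s \<in> I \<and> s \<noteq> t"
    unfolding F_def eventually_at_filter by simp
  define S where "S s = (\<Sum>i<n. \<bar>w s $ i - w t $ i\<bar>)" for s
  \<comment> \<open>The summand 1 puts \<open>K\<close> strictly above the limit of the summed
    absolute difference quotients, so these are eventually below \<open>K\<close>; it also keeps
    \<open>K\<close> positive when \<open>d\<close> vanishes or \<open>n = 0\<close>.\<close>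
  define K where "K = (\<Sum>i<n. \<bar>d $ i\<bar>) + 1"
  have K: "K > 0" unfolding K_def by (intro add_nonneg_pos sum_nonneg) auto
  have "((\<lambda>s. w s $ i) \<longlongrightarrow> w t $ i) F" if "i < n" for i
    using DERIV_continuous[OF w'[OF that]] unfolding continuous_within F_def .
  then have "(S \<longlongrightarrow> (\<Sum>i<n. \<bar>w t $ i - w t $ i\<bar>)) F"
    unfolding S_def by (intro tendsto_intros) auto
  then have S0: "(S \<longlongrightarrow> 0) F" by simp
  have "((\<lambda>s. \<Sum>i<n. \<bar>(w s $ i - w t $ i) / (s - t)\<bar>) \<longlongrightarrow> (\<Sum>i<n. \<bar>d $ i\<bar>)) F"
    using w' unfolding has_field_derivative_iff F_def by (intro tendsto_intros) auto
  then have SK: "\<forall>\<^sub>F s in F. (\<Sum>i<n. \<bar>(w s $ i - w t $ i) / (s - t)\<bar>) < K"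
    by (rule order_tendstoD) (simp add: K_def)
  \<comment> \<open>The expression is the remainder of the expansion at \<open>w t\<close>, divided
    by \<open>s - t\<close>.\<close>
  have "((\<lambda>s. (f (w s) - f (w t)) / (s - t) - (\<Sum>i<n. g $ i * ((w s $ i - w t $ i) / (s - t)))) \<longlongrightarrow> 0) F"
    unfolding tendsto_iff dist_real_def diff_0_right
  proof (intro allI impI)
    fix \<epsilon> :: real assume \<epsilon>: "\<epsilon> > 0"
    \<comment> \<open>The factor \<open>K\<close> from the Lipschitz-type bound
      \<open>S s < K * \<bar>s - t\<bar>\<close> will cancel against this choice.\<close>
    have "\<epsilon> / K > 0" using \<epsilon> K by simp
    from has_gradientD[OF g this] obtain \<delta> where \<delta>: "\<delta> > 0" "\<And>h. h \<in> carrier_vec n \<Longrightarrow> vec_norm h < \<delta> \<Longrightarrow>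
        \<bar>f (w t + h) - f (w t) - g \<bullet> h\<bar> \<le> \<epsilon> / K * vec_norm h"
      by blast
    have "\<forall>\<^sub>F s in F. S s < \<delta>" using S0 \<delta>(1) by (rule order_tendstoD)
    with inI SK show "\<forall>\<^sub>F s in F. \<bar>(f (w s) - f (w t)) / (s - t)
        - (\<Sum>i<n. g $ i * ((w s $ i - w t $ i) / (s - t)))\<bar> < \<epsilon>"
    proof eventually_elim
      case (elim s)
      define h where "h = w s - w t"
      have h: "h \<in> carrier_vec n" "w t + h = w s" "\<And>i. i < n \<Longrightarrow> h $ i = w s $ i - w t $ i"
        using w[of s] w[OF t] elim by (auto simp: h_def)
      have hS: "vec_norm h \<le> S s"
        using vec_norm_le_sum_abs[OF h(1)] h(3) by (simp add: S_def)
      have gh: "g \<bullet> h = (\<Sum>i<n. g $ i * (w s $ i - w t $ i))"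
        using h gc by (simp add: scalar_prod_def lessThan_atLeast0)
      have st: "\<bar>s - t\<bar> > 0" using elim by simp
      have "(\<Sum>i<n. \<bar>(w s $ i - w t $ i) / (s - t)\<bar>) = S s / \<bar>s - t\<bar>"
        by (simp add: S_def sum_divide_distrib)
      then have "S s / \<bar>s - t\<bar> < K" using elim by argo
      then have SK': "S s < K * \<bar>s - t\<bar>" using st by (simp only: pos_divide_less_eq)
      have "\<bar>f (w s) - f (w t) - g \<bullet> h\<bar> \<le> \<epsilon> / K * vec_norm h"
        using \<delta>(2)[OF h(1)] hS elim h(2) by simp
      also have "\<dots> \<le> \<epsilon> / K * S s" using hS \<epsilon> K by (intro mult_left_mono) auto
      also have "\<dots> < \<epsilon> / K * (K * \<bar>s - t\<bar>)" using SK' \<epsilon> K by (intro mult_strict_left_mono) auto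
      also have "\<dots> = \<epsilon> * \<bar>s - t\<bar>" using K by simp
      finally have "\<bar>f (w s) - f (w t) - g \<bullet> h\<bar> / \<bar>s - t\<bar> < \<epsilon>"
        using st by (simp add: field_simps)
      moreover have "(f (w s) - f (w t)) / (s - t) - (\<Sum>i<n. g $ i * ((w s $ i - w t $ i) / (s - t)))
          = (f (w s) - f (w t) - g \<bullet> h) / (s - t)"
        by (simp add: gh diff_divide_distrib[of "f (w s) - f (w t)"] sum_divide_distrib)
      ultimately show ?case by simp
    qed
  qed
  moreover have "((\<lambda>s. \<Sum>i<n. g $ i * ((w s $ i - w t $ i) / (s - t))) \<longlongrightarrow> (\<Sum>i<n. g $ i * d $ i)) F"
    using w' unfolding has_field_derivative_iff F_def by (intro tendsto_intros) auto
  \<comment> \<open>Remainder and linear part add up to the difference quotient; the limit keeps the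
    form \<open>0 + ...\<close> to match \<open>tendsto_add\<close>.\<close>
  ultimately have "((\<lambda>s. (f (w s) - f (w t)) / (s - t)) \<longlongrightarrow> 0 + (\<Sum>i<n. g $ i * d $ i)) F"
    by (rule tendsto_add[THEN tendsto_cong[THEN iffD1, rotated]]) simp
  moreover have "g \<bullet> d = (\<Sum>i<n. g $ i * d $ i)"
    using d by (simp add: scalar_prod_def lessThan_atLeast0)
  ultimately show ?thesis unfolding has_field_derivative_iff F_def by simp
qed

section \<open>The energy along a pair of differentiable curves\<close>

lemma has_field_derivative_transform:
  assumes "x \<in> S" "\<And>y. y \<in> S \<Longrightarrow> g y = f y" "(f has_field_derivative D) (at x within S)"
  shows "(g has_field_derivative D) (at x within S)"
  using assms unfolding has_field_derivative_def by (rule has_derivative_transform)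

lemma C1_curve_component_derivative:
  assumes "C1_curve n I z" "t \<in> I" "i < n"
  shows "((\<lambda>s. z s $ i) has_real_derivative curve_deriv n I z t $ i) (at t within I)"
  using assms
  by (simp add: C1_curve_def curve_deriv_def has_real_derivative_iff_has_vector_derivative
      vector_derivative_works)

text \<open>The chain rule is applied to the concatenated curve, and the joint gradient is then cut
  into its two blocks, which uniqueness identifies with the partial gradients. The second claim
  records a dimension that the description operator behind \<open>grad\<close> does not provide by
  itself.\<close>

lemma C1_fun2_chain:
  assumes f: "C1_fun2 n1 n2 f"
    and z: "C1_curve n1 I z1" "C1_curve n2 I z2" and t: "t \<in> I"
  shows "((\<lambda>s. f (z1 s) (z2 s)) has_real_derivative
      grad n1 (\<lambda>x. f x (z2 t)) (z1 t) \<bullet> curve_deriv n1 I z1 t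
      + grad n2 (\<lambda>x. f (z1 t) x) (z2 t) \<bullet> curve_deriv n2 I z2 t) (at t within I)"
    and "grad n1 (\<lambda>x. f x (z2 t)) (z1 t) \<in> carrier_vec n1"
proof -
  let ?f = "\<lambda>w. f (vec_first w n1) (vec_last w n2)"
  let ?z1' = "curve_deriv n1 I z1 t" and ?z2' = "curve_deriv n2 I z2 t"
  have zc: "z1 s \<in> carrier_vec n1" "z2 s \<in> carrier_vec n2" if "s \<in> I" for s
    using z that by (auto simp: C1_curve_def)
  have dc: "?z1' \<in> carrier_vec n1" "?z2' \<in> carrier_vec n2"
    by (simp_all add: curve_deriv_def)
  have "z1 t @\<^sub>v z2 t \<in> carrier_vec (n1 + n2)" using zc[OF t] by simp
  then obtain g where g: "has_gradient (n1 + n2) ?f g (z1 t @\<^sub>v z2 t)"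
    using f unfolding C1_fun2_def C1_fun_def by blast
  define g1 g2 where "g1 = vec_first g n1" and "g2 = vec_last g n2"
  have gc: "g1 \<in> carrier_vec n1" "g2 \<in> carrier_vec n2" by (simp_all add: g1_def g2_def)
  have "g1 @\<^sub>v g2 = g"
    using g unfolding has_gradient_def g1_def g2_def by simp
  with g have g: "has_gradient (n1 + n2) ?f (g1 @\<^sub>v g2) (z1 t @\<^sub>v z2 t)" by simp
  \<comment> \<open>Each block is a gradient of the function with the other argument frozen, so
    \<open>grad_eq\<close> applies.\<close>
  have eq: "grad n1 (\<lambda>x. f x (z2 t)) (z1 t) = g1" "grad n2 (\<lambda>x. f (z1 t) x) (z2 t) = g2"
    by (rule grad_eq, rule has_gradient_partial[OF g gc zc[OF t]])+
  show "grad n1 (\<lambda>x. f x (z2 t)) (z1 t) \<in> carrier_vec n1" using eq gc by simp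
  have "((\<lambda>s. ?f (z1 s @\<^sub>v z2 s)) has_real_derivative (g1 @\<^sub>v g2) \<bullet> (?z1' @\<^sub>v ?z2')) (at t within I)"
  proof (rule has_gradient_chain[where w = \<open>\<lambda>s. z1 s @\<^sub>v z2 s\<close>, OF g _ t])
    fix i assume i: "i < n1 + n2"
    show "((\<lambda>s. (z1 s @\<^sub>v z2 s) $ i) has_real_derivative (?z1' @\<^sub>v ?z2') $ i) (at t within I)"
    \<comment> \<open>An index below \<open>n1\<close> reads a component of \<open>z1\<close>, any
      other reads \<open>z2\<close> at \<open>i - n1\<close>. This is known only for times in
      \<open>I\<close>, since elsewhere the dimension of \<open>z1 s\<close> is unspecified; hence
      the transfer lemma.\<close>
    proof (cases "i < n1")
      case True
      show ?thesis
        by (rule has_field_derivative_transform[OF t _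
              C1_curve_component_derivative[OF z(1) t True, THEN DERIV_cong]])
          (use zc[THEN carrier_vecD] dc[THEN carrier_vecD] i True in auto)
    next
      case False
      then have i': "i - n1 < n2" using i by simp
      show ?thesis
        by (rule has_field_derivative_transform[OF t _
              C1_curve_component_derivative[OF z(2) t i', THEN DERIV_cong]])
          (use zc[THEN carrier_vecD] dc[THEN carrier_vecD] i False in auto)
    qed
  qed (use zc dc in auto)
  then have "((\<lambda>s. ?f (z1 s @\<^sub>v z2 s)) has_real_derivative g1 \<bullet> ?z1' + g2 \<bullet> ?z2') (at t within I)"
    by (simp add: scalar_prod_append[OF gc dc])
  moreover have "f (z1 s) (z2 s) = ?f (z1 s @\<^sub>v z2 s)" if "s \<in> I" for s
  proof -
    have "vec_first (z1 s @\<^sub>v z2 s) n1 = z1 s" "vec_last (z1 s @\<^sub>v z2 s) n2 = z2 s"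
      using zc[OF that] by (auto simp: vec_first_def vec_last_def)
    then show ?thesis by simp
  qed
  ultimately show "((\<lambda>s. f (z1 s) (z2 s)) has_real_derivative
      grad n1 (\<lambda>x. f x (z2 t)) (z1 t) \<bullet> ?z1' + grad n2 (\<lambda>x. f (z1 t) x) (z2 t) \<bullet> ?z2') (at t within I)"
    unfolding eq by (rule has_field_derivative_transform[OF t, rotated])
qed

section \<open>The power balance\<close>

lemma skew_symmetric_quadratic_form:
  fixes J :: "real mat"
  assumes J: "J \<in> carrier_mat n n" "J = - transpose_mat J" and v: "v \<in> carrier_vec n"
  shows "v \<bullet> (J *\<^sub>v v) = 0"
proof -
  have Jv: "J *\<^sub>v v \<in> carrier_vec n" using J(1) v by simp
  \<comment> \<open>Moving \<open>J\<close> across the inner product replaces it by its transpose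
    \<open>- J\<close>, so the quadratic form equals its own negative.\<close>
  have "transpose_mat J = - J" using J by (metis uminus_uminus_mat)
  then have "v \<bullet> (J *\<^sub>v v) = (- J *\<^sub>v v) \<bullet> v"
    using transpose_vec_mult_scalar[OF J(1) v v] by simp
  also have "\<dots> = - (v \<bullet> (J *\<^sub>v v))"
    using J(1) v Jv by (simp add: uminus_mult_mat_vec comm_scalar_prod[OF v Jv])
  finally show ?thesis by simp
qed

theorem theorem3:
  fixes n1 n2 n3 m n :: nat
    and H :: "real vec \<Rightarrow> real vec \<Rightarrow> real"
    and e :: "real vec \<Rightarrow> real vec \<Rightarrow> real vec"
    and E J R B :: "real mat"
    and t0 tf :: real
    and u y z1 z2 z3 :: "real \<Rightarrow> real vec"
  assumes n: "n = n1 + n2 + n3"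
    and H: "C1_fun2 n1 n2 H"
    and e: "continuous_map (prod_topology (vec_top n1) (vec_top n2)) (vec_top n2)
              (\<lambda>(x1, x2). e x1 x2)"
    and E: "E \<in> carrier_mat n2 n2"
    and J: "J \<in> carrier_mat n n" "J = - transpose_mat J"
    and R: "R \<in> carrier_mat n n" "R = transpose_mat R"
           "\<forall>x\<in>carrier_vec n. x \<bullet> (R *\<^sub>v x) \<ge> 0"
    and B: "B \<in> carrier_mat n m"
    and effort: "\<forall>x1\<in>carrier_vec n1. \<forall>x2\<in>carrier_vec n2.
              transpose_mat E *\<^sub>v e x1 x2 = grad n2 (\<lambda>x. H x1 x) x2"
    and t: "t0 < tf"
    and u: "C0_curve m {t0..tf} u"
    and z: "C1_curve n1 {t0..tf} z1" "C1_curve n2 {t0..tf} z2" "C1_curve n3 {t0..tf} z3"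
    and y: "C0_curve m {t0..tf} y"
    and state_eq: "\<forall>t\<in>{t0..tf}.
              grad n1 (\<lambda>x. H x (z2 t)) (z1 t)
                @\<^sub>v (E *\<^sub>v curve_deriv n2 {t0..tf} z2 t) @\<^sub>v 0\<^sub>v n3
              = (J - R) *\<^sub>v (curve_deriv n1 {t0..tf} z1 t @\<^sub>v e (z1 t) (z2 t) @\<^sub>v z3 t)
                + B *\<^sub>v u t"
    and output_eq: "\<forall>t\<in>{t0..tf}.
              y t = transpose_mat B
                *\<^sub>v (curve_deriv n1 {t0..tf} z1 t @\<^sub>v e (z1 t) (z2 t) @\<^sub>v z3 t)"
  shows "(\<forall>t\<in>{t0..tf}. \<exists>D.
            ((\<lambda>s. H (z1 s) (z2 s)) has_real_derivative D) (at t within {t0..tf})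
            \<and> D \<le> y t \<bullet> u t)
       \<and> ((\<forall>t\<in>{t0..tf}. u t = 0\<^sub>v m) \<longrightarrow>
            (\<forall>t\<in>{t0..tf}. \<exists>D.
               ((\<lambda>s. H (z1 s) (z2 s)) has_real_derivative D) (at t within {t0..tf})
               \<and> D \<le> 0))"
proof -
  let ?I = "{t0..tf}"
  have main: "\<exists>D. ((\<lambda>s. H (z1 s) (z2 s)) has_real_derivative D) (at t within ?I) \<and> D \<le> y t \<bullet> u t"
    if tI: "t \<in> ?I" for t
  proof -
    define d1 d2 where "d1 = curve_deriv n1 ?I z1 t" and "d2 = curve_deriv n2 ?I z2 t"
    define g1 g2 where "g1 = grad n1 (\<lambda>x. H x (z2 t)) (z1 t)"
      and "g2 = grad n2 (\<lambda>x. H (z1 t) x) (z2 t)"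
    define et where "et = e (z1 t) (z2 t)"
    \<comment> \<open>The state equation is tested with the same vector that \<open>B\<close>
      transposed maps to the output.\<close>
    define v where "v = d1 @\<^sub>v et @\<^sub>v z3 t"
    have zc: "z1 t \<in> carrier_vec n1" "z2 t \<in> carrier_vec n2" "z3 t \<in> carrier_vec n3"
      using z tI by (auto simp: C1_curve_def)
    have dc: "d1 \<in> carrier_vec n1" "d2 \<in> carrier_vec n2"
      by (simp_all add: d1_def d2_def curve_deriv_def)
    have g1: "g1 \<in> carrier_vec n1"
      unfolding g1_def by (rule C1_fun2_chain(2)[OF H z(1,2) tI])
    have ec: "et \<in> carrier_vec n2"
      using continuous_map_image_subset_topspace[OF e] zc unfolding et_def by auto
    have vc: "v \<in> carrier_vec n"
      unfolding v_def n add.assoc using dc ec zc by simp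
    have uc: "u t \<in> carrier_vec m"
      using continuous_map_image_subset_topspace[OF u[unfolded C0_curve_def]] tI by auto
    have Ed2: "E *\<^sub>v d2 \<in> carrier_vec n2" using E dc by simp
    have st: "g1 @\<^sub>v (E *\<^sub>v d2) @\<^sub>v 0\<^sub>v n3 = (J - R) *\<^sub>v v + B *\<^sub>v u t"
      using state_eq tI unfolding g1_def d1_def d2_def et_def v_def by blast
    have g2: "g2 = transpose_mat E *\<^sub>v et"
      using effort zc unfolding g2_def et_def by simp
    \<comment> \<open>The concatenation is nested to the right, so the product splits in two rounds;
      \<open>z3 t\<close> meets the zero block and drops out.\<close>
    have "v \<bullet> (g1 @\<^sub>v (E *\<^sub>v d2) @\<^sub>v 0\<^sub>v n3) = d1 \<bullet> g1 + (et \<bullet> (E *\<^sub>v d2) + z3 t \<bullet> 0\<^sub>v n3)"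
      unfolding v_def
      by (subst scalar_prod_append[OF dc(1) _ g1], use zc ec Ed2 in auto)
        (subst scalar_prod_append[OF ec zc(3) Ed2], auto)
    also have "\<dots> = g1 \<bullet> d1 + g2 \<bullet> d2"
      \<comment> \<open>Shifting \<open>E\<close> from \<open>d2\<close> onto the effort turns the
        second block into the gradient term \<open>g2 \<bullet> d2\<close>.\<close>
      using zc transpose_vec_mult_scalar[OF E dc(2) ec] comm_scalar_prod[OF dc(1) g1]
      by (simp add: g2)
    finally have D: "g1 \<bullet> d1 + g2 \<bullet> d2 = v \<bullet> ((J - R) *\<^sub>v v + B *\<^sub>v u t)" using st by simp
    have c: "J *\<^sub>v v \<in> carrier_vec n" "R *\<^sub>v v \<in> carrier_vec n" "B *\<^sub>v u t \<in> carrier_vec n"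
      using J R B vc uc by auto
    have "v \<bullet> (B *\<^sub>v u t) = y t \<bullet> u t"
      using transpose_vec_mult_scalar[OF B uc vc] output_eq tI
      unfolding v_def d1_def et_def by simp
    moreover have "v \<bullet> ((J - R) *\<^sub>v v + B *\<^sub>v u t)
        = v \<bullet> (J *\<^sub>v v) - v \<bullet> (R *\<^sub>v v) + v \<bullet> (B *\<^sub>v u t)"
      using c vc by (simp add: minus_mult_distrib_mat_vec[OF J(1) R(1) vc]
          scalar_prod_add_distrib[of _ n] scalar_prod_minus_distrib[of _ n])
    ultimately have "g1 \<bullet> d1 + g2 \<bullet> d2 \<le> y t \<bullet> u t"
      using D skew_symmetric_quadratic_form[OF J vc] R(3) vc by simp
    then show ?thesis
      using C1_fun2_chain(1)[OF H z(1,2) tI] unfolding g1_def g2_def d1_def d2_def by blast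
  qed
  \<comment> \<open>With this dimension, \<open>y t \<bullet> 0\<^sub>v m\<close> is 0, which
    reduces the case of zero input to \<open>main\<close>.\<close>
  have "y t \<in> carrier_vec m" if "t \<in> ?I" for t
    using continuous_map_image_subset_topspace[OF y[unfolded C0_curve_def]] that by auto
  then show ?thesis
    using main by (metis scalar_prod_right_zero)
qed

end
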